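(* Let $\beta>0$. (1D) There exists a unique positive eigenvector for the one-dimensional discretized problem: there is exactly one vector $\varphi\in\mathbb{R}^n$ with all components positive for which there is $\lambda\in\mathbb{R}$ with $$D\varphi+\beta\varphi^3-\lambda\varphi=0,\qquad \tfrac12\left(\tfrac1h-\varphi^{\mathrm T}\varphi\right)=0,$$ where $D$ and $h$ are the matrix and mesh size of the one-dimensional problem. (2D) There exists a unique positive eigenvector for the two-dimensional discretized problem: there is exactly one vector $\varphi\in\mathbb{R}^{mn}$ with all components positive for which there is $\lambda\in\mathbb{R}$ with $$D\varphi+\beta\varphi^3-\lambda\varphi=0,\qquad \tfrac12\left(\tfrac1{h_1h_2}-\varphi^{\mathrm T}\varphi\right)=0,$$ where $D$, $h_1$, $h_2$ are the matrix and step sizes of the two-dimensional problem.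
   Context: For a vector $\varphi$, $\varphi^3$ denotes the vector of componentwise cubes. One-dimensional problem: $\Omega=[a,b]\subset\mathbb{R}$, $n\in\mathbb{N}^+$, $h=\frac{b-a}{n+1}$, $x_j=a+jh$, $V(x)=\frac12x^2$, $v_j=V(x_j)$ for $j=1,\dots,n$. The matrix $D\in\mathbb{R}^{n\times n}$ is $D=\frac12D_1+\mathrm{diag}(v_1,\dots,v_n)$, where $D_1$ is $\frac1{h^2}$ times the tridiagonal matrix with $2$ on the diagonal and $-1$ on the sub- and superdiagonals. Two-dimensional problem: $\Omega=[a,b]\times[c,d]$, $m,n\in\mathbb{N}^+$, $h_1=\frac{b-a}{m+1}$, $h_2=\frac{d-c}{n+1}$, $x_i=a+ih_1$, $y_j=c+jh_2$, $V(x,y)=\frac12(x^2+y^2)$, $v_{ij}=V(x_i,y_j)$. Vectors are ordered $\varphi=(\varphi_{11},\dots,\varphi_{1n},\dots,\varphi_{m1},\dots,\varphi_{mn})^{\mathrm T}$. The matrix $D\in\mathbb{R}^{mn\times mn}$ is block tridiagonal with $m\times m$ blocks of size $n\times n$: the $i$-th diagonal block is $\frac12D_{ii}+\mathrm{diag}(v_{i1},\dots,v_{in})$, where $D_{ii}$ is tridiagonal with diagonal entries $\frac2{h_1^2}+\frac2{h_2^2}$ and sub- and superdiagonal entries $-\frac1{h_2^2}$; the blocks immediately above and below the block diagonal are $-\frac1{2h_1^2}I_n$; all other blocks are zero. *)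

theory Defs
  imports Complex_Main "Jordan_Normal_Form.Matrix"
begin

text \<open>Matrices and vectors are indexed from 0, whereas the interior grid points and the blocks
  are numbered from 1. Hence component (or block) number \<^term>\<open>k\<close> belongs to \<^term>\<open>Suc k\<close>.\<close>

definition mesh :: "real \<Rightarrow> real \<Rightarrow> nat \<Rightarrow> real" where
  "mesh a b n = (b - a) / (real n + 1)"

definition grid_point :: "real \<Rightarrow> real \<Rightarrow> nat \<Rightarrow> nat \<Rightarrow> real" where
  "grid_point a b n j = a + real j * mesh a b n"

definition tridiag :: "nat \<Rightarrow> real \<Rightarrow> real \<Rightarrow> real mat" where
  "tridiag n d e =
     mat n n (\<lambda>(i, j). if i = j then d else if i = Suc j \<or> j = Suc i then e else 0)"

definition cube_vec :: "real vec \<Rightarrow> real vec" where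
  "cube_vec \<phi> = map_vec (\<lambda>t. t ^ 3) \<phi>"

definition positive_vec :: "real vec \<Rightarrow> bool" where
  "positive_vec \<phi> \<longleftrightarrow> (\<forall>k < dim_vec \<phi>. 0 < \<phi> $ k)"

definition V1 :: "real \<Rightarrow> real" where
  "V1 x = 1/2 * x ^ 2"

definition D_1d :: "real \<Rightarrow> real \<Rightarrow> nat \<Rightarrow> real mat" where
  "D_1d a b n =
     (1/2) \<cdot>\<^sub>m ((1 / (mesh a b n) ^ 2) \<cdot>\<^sub>m tridiag n 2 (- 1))
     + mat_diag n (\<lambda>k. V1 (grid_point a b n (Suc k)))"

definition V2 :: "real \<Rightarrow> real \<Rightarrow> real" where
  "V2 x y = 1/2 * (x ^ 2 + y ^ 2)"

definition diag_block_2d ::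
  "real \<Rightarrow> real \<Rightarrow> real \<Rightarrow> real \<Rightarrow> nat \<Rightarrow> nat \<Rightarrow> nat \<Rightarrow> real mat" where
  "diag_block_2d a b c d m n p =
     (let h1 = mesh a b m; h2 = mesh c d n in
        (1/2) \<cdot>\<^sub>m tridiag n (2 / h1 ^ 2 + 2 / h2 ^ 2) (- (1 / h2 ^ 2))
        + mat_diag n (\<lambda>q. V2 (grid_point a b m (Suc p)) (grid_point c d n (Suc q))))"

definition block_2d ::
  "real \<Rightarrow> real \<Rightarrow> real \<Rightarrow> real \<Rightarrow> nat \<Rightarrow> nat \<Rightarrow> nat \<Rightarrow> nat \<Rightarrow> real mat" where
  "block_2d a b c d m n p p' =
     (if p = p' then diag_block_2d a b c d m n p
      else if p = Suc p' \<or> p' = Suc p then (- (1 / (2 * (mesh a b m) ^ 2))) \<cdot>\<^sub>m 1\<^sub>m n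
      else 0\<^sub>m n n)"

text \<open>In the ordering \<open>(\<phi>\<^sub>1\<^sub>1, \<dots>, \<phi>\<^sub>1\<^sub>n, \<dots>, \<phi>\<^sub>m\<^sub>1, \<dots>, \<phi>\<^sub>m\<^sub>n)\<close>, position
  \<open>k\<close> lies in block \<open>k div n\<close>, at offset \<open>k mod n\<close>.\<close>

definition D_2d :: "real \<Rightarrow> real \<Rightarrow> real \<Rightarrow> real \<Rightarrow> nat \<Rightarrow> nat \<Rightarrow> real mat" where
  "D_2d a b c d m n =
     mat (m * n) (m * n)
       (\<lambda>(k, l). block_2d a b c d m n (k div n) (l div n) $$ (k mod n, l mod n))"

end

theory Submission
  imports Defs "HOL-Analysis.Function_Topology"
begin

text \<open>A positive solution is found by minimizing the energy
  \<open>1/2 \<phi>\<^sup>T D \<phi> + \<beta>/4 \<Sum> \<phi>\<^sub>k\<^sup>4\<close> on a sphere. Since the off-diagonal entries of \<open>D\<close> are nonpositive,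
  passing to absolute values does not increase the energy, so there is a nonnegative minimizer; it solves the Lagrange equation, by which a zero component forces the
  neighbouring components to vanish, and so it is positive because \<open>D\<close> is irreducible. For
  uniqueness, the Diaz--Saa (Picone) inequality says that
  \<open>\<Sum> (\<phi>\<^sub>k\<^sup>2 - \<psi>\<^sub>k\<^sup>2) ((D\<phi>)\<^sub>k/\<phi>\<^sub>k - (D\<psi>)\<^sub>k/\<psi>\<^sub>k)\<close> is nonnegative.
  For two solutions on the same sphere the eigenvalues drop out of this sum, which
  equals \<open>- \<beta> \<Sum> (\<phi>\<^sub>k\<^sup>2 - \<psi>\<^sub>k\<^sup>2)\<^sup>2\<close>, so the two vectors coincide.\<close>

section \<open>The energy functional and its derivative\<close>

definition energy :: "nat \<Rightarrow> (nat \<Rightarrow> nat \<Rightarrow> real) \<Rightarrow> real \<Rightarrow> (nat \<Rightarrow> real) \<Rightarrow> real" where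
  "energy N A \<beta> f =
     1/2 * (\<Sum>i<N. \<Sum>j<N. A i j * f i * f j) + \<beta>/4 * (\<Sum>i<N. f i ^ 4)"

text \<open>For symmetric \<open>A\<close> this is the Euclidean gradient of \<open>energy\<close>,
  so the nonlinear eigenvalue equation says that it is a multiple of \<open>f\<close>.\<close>

definition gradient :: "nat \<Rightarrow> (nat \<Rightarrow> nat \<Rightarrow> real) \<Rightarrow> real \<Rightarrow> (nat \<Rightarrow> real) \<Rightarrow> nat \<Rightarrow> real" where
  "gradient N A \<beta> f i = (\<Sum>j<N. A i j * f j) + \<beta> * f i ^ 3"

text \<open>Strong connectivity of the directed graph of nonzero entries, phrased through closed
  sets so that it applies directly to the zero set of a function.\<close>

definition irreducible_mat :: "nat \<Rightarrow> (nat \<Rightarrow> nat \<Rightarrow> real) \<Rightarrow> bool" where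
  "irreducible_mat N A \<longleftrightarrow>
     (\<forall>P. (\<exists>k<N. P k) \<longrightarrow> (\<forall>k<N. \<forall>l<N. P k \<longrightarrow> A k l \<noteq> 0 \<longrightarrow> P l) \<longrightarrow> (\<forall>l<N. P l))"

text \<open>Chain rule along a curve: symmetry of \<open>A\<close> merges the two halves of the
  product rule and absorbs the factor 1/2.\<close>

lemma energy_derivative:
  assumes sym: "\<And>i j. i < N \<Longrightarrow> j < N \<Longrightarrow> A i j = A j i"
    and der: "\<And>i. ((\<lambda>t. \<gamma> t i) has_real_derivative h i) (at t)"
  shows "((\<lambda>t. energy N A \<beta> (\<gamma> t)) has_real_derivative
           (\<Sum>i<N. h i * gradient N A \<beta> (\<gamma> t) i)) (at t)"
proof -
  let ?f = "\<gamma> t"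
  have "((\<lambda>t. energy N A \<beta> (\<gamma> t)) has_real_derivative
      1/2 * (\<Sum>i<N. \<Sum>j<N. A i j * h i * ?f j + A i j * ?f i * h j)
      + \<beta>/4 * (\<Sum>i<N. 4 * ?f i ^ 3 * h i)) (at t)"
    unfolding energy_def
    by (rule derivative_eq_intros der refl sum.cong | simp add: algebra_simps)+
  moreover have "(\<Sum>i<N. \<Sum>j<N. A i j * ?f i * h j) = (\<Sum>i<N. \<Sum>j<N. A i j * h i * ?f j)"
    by (subst sum.swap) (intro sum.cong refl, simp add: sym mult_ac)
  then have "1/2 * (\<Sum>i<N. \<Sum>j<N. A i j * h i * ?f j + A i j * ?f i * h j) =
      (\<Sum>i<N. \<Sum>j<N. A i j * h i * ?f j)"
    by (simp add: sum.distrib)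
  then have "1/2 * (\<Sum>i<N. \<Sum>j<N. A i j * h i * ?f j + A i j * ?f i * h j)
      + \<beta>/4 * (\<Sum>i<N. 4 * ?f i ^ 3 * h i) = (\<Sum>i<N. h i * gradient N A \<beta> ?f i)"
    by (simp add: gradient_def sum.distrib sum_distrib_left distrib_left mult_ac)
  ultimately show ?thesis
    by simp
qed

text \<open>Absolute values leave the diagonal and quartic terms unchanged and can only enlarge
  \<open>f i * f j\<close>, which is weighted by a nonpositive entry.\<close>

lemma energy_abs_le:
  assumes off: "\<And>i j. i < N \<Longrightarrow> j < N \<Longrightarrow> i \<noteq> j \<Longrightarrow> A i j \<le> 0"
  shows "energy N A \<beta> (\<lambda>i. \<bar>f i\<bar>) \<le> energy N A \<beta> f"
proof -
  have "A i j * \<bar>f i\<bar> * \<bar>f j\<bar> \<le> A i j * f i * f j" if "i < N" "j < N" for i j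
  proof (cases "i = j")
    case True
    then show ?thesis by (simp add: mult.assoc)
  next
    case False
    have "f i * f j \<le> \<bar>f i\<bar> * \<bar>f j\<bar>"
      by (metis abs_ge_self abs_mult)
    then show ?thesis
      using mult_left_mono_neg[OF _ off[OF that False]] by (simp add: mult.assoc)
  qed
  then show ?thesis
    unfolding energy_def by (auto intro!: add_mono mult_left_mono sum_mono)
qed

section \<open>Existence of a positive solution by minimization\<close>

lemma exists_energy_minimizer:
  fixes r :: real
  assumes "0 < r" "0 < N"
  obtains f where "(\<Sum>i<N. f i ^ 2) = r"
    and "\<And>g. (\<Sum>i<N. g i ^ 2) = r \<Longrightarrow> energy N A \<beta> f \<le> energy N A \<beta> g"
proof -
  \<comment> \<open>The sphere alone is not compact, since coordinates from \<open>N\<close> on are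
    free. Pinning them to 0 and bounding the others by \<open>sqrt r\<close> gives a box that is
    compact by Tychonoff.\<close>
  let ?B = "PiE UNIV (\<lambda>i. if i < N then {- sqrt r..sqrt r} else {0})"
  let ?S = "{f. (\<Sum>i<N. f i ^ 2) = r}"
  have "compactin (product_topology (\<lambda>i. euclidean) UNIV) ?B"
    unfolding compactin_PiE by (auto simp: compactin_euclidean_iff)
  then have "compact ?B"
    by (simp add: euclidean_product_topology compactin_euclidean_iff)
  moreover have "closed ?S"
  proof -
    have "continuous_on UNIV (\<lambda>f::nat \<Rightarrow> real. \<Sum>i<N. f i ^ 2)"
      by (intro continuous_intros continuous_on_product_coordinates)
    from closed_vimage[OF closed_singleton[of r] this] show ?thesis
      by (simp add: vimage_def)
  qed
  ultimately have comp: "compact (?B \<inter> ?S)"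
    by (rule compact_Int_closed)
  have "(\<lambda>i. if i = 0 then sqrt r else 0) \<in> ?B \<inter> ?S"
    using assms by (auto simp: if_distrib[of "\<lambda>x. x ^ 2"] cong: if_cong)
  then have ne: "?B \<inter> ?S \<noteq> {}"
    by blast
  have cont: "continuous_on (?B \<inter> ?S) (energy N A \<beta>)"
    unfolding energy_def
    by (intro continuous_intros continuous_on_subset[OF continuous_on_product_coordinates] subset_UNIV)
  obtain f where f: "f \<in> ?B \<inter> ?S"
    and min: "\<And>g. g \<in> ?B \<inter> ?S \<Longrightarrow> energy N A \<beta> f \<le> energy N A \<beta> g"
    using continuous_attains_inf[OF comp ne cont] by blast
  have "energy N A \<beta> f \<le> energy N A \<beta> g" if g: "(\<Sum>i<N. g i ^ 2) = r" for g
  proof -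
    \<comment> \<open>Energy and norm see only coordinates below \<open>N\<close>, so a competitor
      may be truncated to fit into the box.\<close>
    let ?g = "\<lambda>i. if i < N then g i else 0"
    have "\<bar>g i\<bar> \<le> sqrt r" if "i < N" for i
    proof -
      have "g i ^ 2 \<le> (\<Sum>i<N. g i ^ 2)"
        using that by (intro member_le_sum) auto
      then show ?thesis
        using g real_le_rsqrt[of "\<bar>g i\<bar>"] by simp
    qed
    then have "?g \<in> ?B \<inter> ?S"
      using g by (auto simp: abs_le_iff minus_le_iff)
    then have "energy N A \<beta> f \<le> energy N A \<beta> ?g"
      by (rule min)
    also have "energy N A \<beta> ?g = energy N A \<beta> g"
      by (simp add: energy_def)
    finally show ?thesis .
  qed
  with f that show thesis
    by blast
qed

lemma sum_two:
  fixes F :: "nat \<Rightarrow> real"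
  assumes "k < N" "l < N" "k \<noteq> l" "\<And>i. i < N \<Longrightarrow> i \<noteq> k \<Longrightarrow> i \<noteq> l \<Longrightarrow> F i = 0"
  shows "(\<Sum>i<N. F i) = F k + F l"
proof -
  have "(\<Sum>i<N. F i) = (\<Sum>i\<in>{k, l}. F i)"
    using assms by (intro sum.mono_neutral_right) auto
  then show ?thesis
    using assms(3) by simp
qed

text \<open>The Lagrange condition comes from rotating a minimizer in a coordinate plane, which keeps it
  on the sphere.\<close>

lemma gradient_parallel_at_minimizer:
  assumes sym: "\<And>i j. i < N \<Longrightarrow> j < N \<Longrightarrow> A i j = A j i"
    and min: "\<And>g. (\<Sum>i<N. g i ^ 2) = (\<Sum>i<N. f i ^ 2) \<Longrightarrow> energy N A \<beta> f \<le> energy N A \<beta> g"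
    and kl: "k < N" "l < N"
  shows "gradient N A \<beta> f k * f l = gradient N A \<beta> f l * f k"
proof (cases "k = l")
  case False
  \<comment> \<open>Rotation by angle \<open>t\<close> in the plane of coordinates \<open>k\<close>
    and \<open>l\<close>; \<open>h\<close> below is its velocity at \<open>t = 0\<close>.\<close>
  define \<gamma> where "\<gamma> t = f(k := cos t * f k - sin t * f l, l := sin t * f k + cos t * f l)" for t
  define h where "h i = (if i = k then - f l else if i = l then f k else 0)" for i
  have \<gamma>0: "\<gamma> 0 = f"
    by (auto simp: \<gamma>_def)
  have der: "((\<lambda>t. \<gamma> t i) has_real_derivative h i) (at 0)" for i
    using False unfolding \<gamma>_def h_def
    by (cases "i = k"; cases "i = l") (auto intro!: derivative_eq_intros)
  have norm: "(\<Sum>i<N. \<gamma> t i ^ 2) = (\<Sum>i<N. f i ^ 2)" for t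
  proof -
    have "(\<Sum>i<N. \<gamma> t i ^ 2 - f i ^ 2) = (\<gamma> t k ^ 2 - f k ^ 2) + (\<gamma> t l ^ 2 - f l ^ 2)"
      by (rule sum_two) (use kl False in \<open>auto simp: \<gamma>_def\<close>)
    also have "\<dots> = (cos t * f k - sin t * f l) ^ 2 - f k ^ 2 + ((sin t * f k + cos t * f l) ^ 2 - f l ^ 2)"
      using False by (simp add: \<gamma>_def)
    also have "\<dots> = 0"
    proof -
      have "(c * x - s * y) ^ 2 - x ^ 2 + ((s * x + c * y) ^ 2 - y ^ 2) = (s ^ 2 + c ^ 2 - 1) * (x ^ 2 + y ^ 2)"
        for c s x y :: real
        by (simp add: power2_eq_square algebra_simps)
      then show ?thesis by simp
    qed
    finally show ?thesis
      by (simp add: sum_subtractf)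
  qed
  \<comment> \<open>The rotation stays on the sphere, so the energy along it is minimal at
    \<open>t = 0\<close>.\<close>
  have "(\<Sum>i<N. h i * gradient N A \<beta> f i) = 0"
  proof (rule DERIV_local_min)
    show "((\<lambda>t. energy N A \<beta> (\<gamma> t)) has_real_derivative (\<Sum>i<N. h i * gradient N A \<beta> f i)) (at 0)"
      using energy_derivative[of N A \<gamma> h 0 \<beta>] sym der \<gamma>0 by simp
    show "0 < (1::real)" by simp
    show "\<forall>y. \<bar>0 - y\<bar> < 1 \<longrightarrow> energy N A \<beta> (\<gamma> 0) \<le> energy N A \<beta> (\<gamma> y)"
      unfolding \<gamma>0 using min norm by blast
  qed
  moreover have "(\<Sum>i<N. h i * gradient N A \<beta> f i) = h k * gradient N A \<beta> f k + h l * gradient N A \<beta> f l"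
    by (rule sum_two) (use kl False in \<open>auto simp: h_def\<close>)
  ultimately show ?thesis
    using False by (simp add: h_def mult.commute)
qed simp

lemma positive_eigenfunction_exists:
  fixes r :: real
  assumes sym: "\<And>i j. i < N \<Longrightarrow> j < N \<Longrightarrow> A i j = A j i"
    and off: "\<And>i j. i < N \<Longrightarrow> j < N \<Longrightarrow> i \<noteq> j \<Longrightarrow> A i j \<le> 0"
    and irr: "irreducible_mat N A"
    and "0 < r" "0 < N"
  obtains f \<mu> where "\<And>i. i < N \<Longrightarrow> 0 < f i" "(\<Sum>i<N. f i ^ 2) = r"
    "\<And>i. i < N \<Longrightarrow> gradient N A \<beta> f i = \<mu> * f i"
proof -
  obtain f0 where f0: "(\<Sum>i<N. f0 i ^ 2) = r"
    and min0: "\<And>g. (\<Sum>i<N. g i ^ 2) = r \<Longrightarrow> energy N A \<beta> f0 \<le> energy N A \<beta> g"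
    using exists_energy_minimizer[OF \<open>0 < r\<close> \<open>0 < N\<close>, of A \<beta>] by blast
  define f where "f i = \<bar>f0 i\<bar>" for i
  have nonneg: "0 \<le> f i" for i
    by (simp add: f_def)
  have norm: "(\<Sum>i<N. f i ^ 2) = r"
    using f0 by (simp add: f_def)
  have min: "energy N A \<beta> f \<le> energy N A \<beta> g" if "(\<Sum>i<N. g i ^ 2) = (\<Sum>i<N. f i ^ 2)" for g
    using energy_abs_le[of N A \<beta> f0] off min0[of g] that norm unfolding f_def by fastforce
  have par: "gradient N A \<beta> f k * f l = gradient N A \<beta> f l * f k" if "k < N" "l < N" for k l
    using gradient_parallel_at_minimizer[of N A f \<beta> k l] sym min that by blast
  have "\<exists>l<N. f l \<noteq> 0"
  proof (rule ccontr)
    assume "\<not> ?thesis"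
    then have "(\<Sum>i<N. f i ^ 2) = 0" by simp
    with norm \<open>0 < r\<close> show False by simp
  qed
  then obtain l where l: "l < N" "f l \<noteq> 0"
    by blast
  \<comment> \<open>A nonzero coordinate fixes the multiplier; parallelism with coordinate
    \<open>l\<close> carries it to all others.\<close>
  define \<mu> where "\<mu> = gradient N A \<beta> f l / f l"
  have eig: "gradient N A \<beta> f i = \<mu> * f i" if "i < N" for i
    using par[OF that l(1)] l by (simp add: \<mu>_def field_simps)
  \<comment> \<open>At a zero of \<open>f\<close> the equation reduces to a vanishing sum of
    nonpositive terms \<open>A i j * f j\<close>, so each term vanishes.\<close>
  have spread: "f j = 0" if "i < N" "j < N" "f i = 0" "A i j \<noteq> 0" for i j
  proof -
    have "(\<Sum>j<N. A i j * f j) = 0"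
      using eig[OF \<open>i < N\<close>] \<open>f i = 0\<close> by (simp add: gradient_def)
    then have "(\<Sum>j<N. - (A i j * f j)) = 0"
      by (simp add: sum_negf)
    moreover have "0 \<le> - (A i j * f j)" if "j < N" for j
      using off[OF \<open>i < N\<close> that] nonneg[of j] \<open>f i = 0\<close>
      by (cases "i = j") (auto simp: mult_nonpos_nonneg)
    ultimately have "- (A i j * f j) = 0"
      using \<open>j < N\<close> sum_nonneg_eq_0_iff[of "{..<N}" "\<lambda>j. - (A i j * f j)"] by simp
    then show ?thesis
      using \<open>A i j \<noteq> 0\<close> by simp
  qed
  have "0 < f i" if "i < N" for i
  proof (rule ccontr)
    assume "\<not> 0 < f i"
    then have "f i = 0"
      using nonneg[of i] by simp
    \<comment> \<open>The zero set is closed under nonzero entries, so a single zero would spread to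
      \<open>l\<close>.\<close>
    then have "f l = 0"
      using irr[unfolded irreducible_mat_def, rule_format, of "\<lambda>i. f i = 0" l] spread that l(1) by blast
    with l show False by simp
  qed
  with norm eig that show thesis by blast
qed

section \<open>The Diaz-Saa inequality and uniqueness\<close>

text \<open>The difference of the two sides is the square
  \<open>(b * c - a * d) ^ 2 / (a * b)\<close>.\<close>

lemma weighted_amgm:
  fixes a b c d :: real
  assumes "0 < a" "0 < b"
  shows "2 * c * d \<le> b * c ^ 2 / a + a * d ^ 2 / b"
proof -
  have "b * c ^ 2 / a + a * d ^ 2 / b - 2 * c * d = (b * c - a * d) ^ 2 / (a * b)"
    using assms by (simp add: field_simps power2_eq_square)
  then show ?thesis
    using assms by (smt (verit) divide_nonneg_pos mult_pos_pos zero_le_power2)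
qed

text \<open>The discrete counterpart of the inequality of Diaz and Saa: the diagonal terms cancel, and the
  off-diagonal ones have a sign after symmetrization.\<close>

lemma diaz_saa:
  fixes f g :: "nat \<Rightarrow> real"
  assumes sym: "\<And>i j. i < N \<Longrightarrow> j < N \<Longrightarrow> A i j = A j i"
    and off: "\<And>i j. i < N \<Longrightarrow> j < N \<Longrightarrow> i \<noteq> j \<Longrightarrow> A i j \<le> 0"
    and f: "\<And>i. i < N \<Longrightarrow> 0 < f i" and g: "\<And>i. i < N \<Longrightarrow> 0 < g i"
  shows "0 \<le> (\<Sum>i<N. (f i ^ 2 - g i ^ 2) * ((\<Sum>j<N. A i j * f j) / f i - (\<Sum>j<N. A i j * g j) / g i))"
proof -
  define T where "T i j = A i j * ((f i ^ 2 - g i ^ 2) * (f j / f i - g j / g i))" for i j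
  have nonneg: "0 \<le> T i j + T j i" if ij: "i < N" "j < N" for i j
  proof (cases "i = j")
    case True
    have "f i / f i = 1" "g i / g i = 1"
      using f[OF ij(1)] g[OF ij(1)] by simp_all
    with True show ?thesis by (simp add: T_def)
  next
    case False
    \<comment> \<open>By symmetry of \<open>A\<close>, \<open>T i j + T j i\<close> is
      \<open>A i j * ?X\<close>. Expanding \<open>?X\<close> leaves two AM-GM deficits: values of
      \<open>f\<close> weighted by \<open>g\<close>, and values of \<open>g\<close> weighted by
      \<open>f\<close>.\<close>
    let ?X = "(f i ^ 2 - g i ^ 2) * (f j / f i - g j / g i) + (f j ^ 2 - g j ^ 2) * (f i / f j - g i / g j)"
    have cancel: "x ^ 2 * (y / x) = x * y" if "0 < x" for x y :: real
      using that by (simp add: power2_eq_square)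
    have "?X = 2 * f i * f j - (g j * f i ^ 2 / g i + g i * f j ^ 2 / g j)
             + (2 * g i * g j - (f j * g i ^ 2 / f i + f i * g j ^ 2 / f j))"
      unfolding left_diff_distrib right_diff_distrib
        cancel[OF f[OF ij(1)]] cancel[OF f[OF ij(2)]] cancel[OF g[OF ij(1)]] cancel[OF g[OF ij(2)]]
      by (simp add: mult_ac)
    also have "\<dots> \<le> 0"
      using weighted_amgm[OF f[OF ij(1)] f[OF ij(2)], of "g i" "g j"]
        weighted_amgm[OF g[OF ij(1)] g[OF ij(2)], of "f i" "f j"] by linarith
    finally have "0 \<le> A i j * ?X"
      using off[OF ij False] by (simp add: mult_nonpos_nonpos)
    then show ?thesis
      using sym[OF ij] by (simp add: T_def algebra_simps)
  qed
  have "(\<Sum>i<N. \<Sum>j<N. T j i) = (\<Sum>i<N. \<Sum>j<N. T i j)"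
    by (rule sum.swap)
  \<comment> \<open>Doubling the sum and transposing one copy pairs \<open>T i j\<close> with
    \<open>T j i\<close>, the only combination whose sign is known.\<close>
  then have "2 * (\<Sum>i<N. \<Sum>j<N. T i j) = (\<Sum>i<N. \<Sum>j<N. T i j) + (\<Sum>i<N. \<Sum>j<N. T j i)"
    by simp
  also have "\<dots> = (\<Sum>i<N. \<Sum>j<N. T i j + T j i)"
    by (simp add: sum.distrib)
  also have "\<dots> \<ge> 0"
    using nonneg by (auto intro!: sum_nonneg)
  finally have "0 \<le> (\<Sum>i<N. \<Sum>j<N. T i j)"
    by simp
  also have "\<dots> = (\<Sum>i<N. (f i ^ 2 - g i ^ 2) * ((\<Sum>j<N. A i j * f j) / f i - (\<Sum>j<N. A i j * g j) / g i))"
    unfolding T_def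
    by (intro sum.cong refl)
      (simp add: sum_distrib_left sum_divide_distrib flip: sum_subtractf, simp add: algebra_simps)
  finally show ?thesis .
qed

text \<open>The multipliers may differ a priori: equal norms remove \<open>\<mu> - \<nu>\<close>
  from the Diaz-Saa sum, and \<open>0 < \<beta>\<close> makes the remaining term
  nonpositive.\<close>

lemma positive_eigenfunction_unique:
  assumes sym: "\<And>i j. i < N \<Longrightarrow> j < N \<Longrightarrow> A i j = A j i"
    and off: "\<And>i j. i < N \<Longrightarrow> j < N \<Longrightarrow> i \<noteq> j \<Longrightarrow> A i j \<le> 0"
    and "0 < \<beta>"
    and f: "\<And>i. i < N \<Longrightarrow> 0 < f i" and g: "\<And>i. i < N \<Longrightarrow> 0 < g i"
    and norm: "(\<Sum>i<N. f i ^ 2) = (\<Sum>i<N. g i ^ 2)"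
    and ef: "\<And>i. i < N \<Longrightarrow> gradient N A \<beta> f i = \<mu> * f i"
    and eg: "\<And>i. i < N \<Longrightarrow> gradient N A \<beta> g i = \<nu> * g i"
    and "i < N"
  shows "f i = g i"
proof -
  \<comment> \<open>Division by the positive component makes the linear quotient affine in
    \<open>u i ^ 2\<close>.\<close>
  have quot: "(\<Sum>j<N. A i j * u j) / u i = \<kappa> - \<beta> * u i ^ 2"
    if "0 < u i" "gradient N A \<beta> u i = \<kappa> * u i" for u \<kappa> i
  proof -
    have "(\<Sum>j<N. A i j * u j) = (\<kappa> - \<beta> * u i ^ 2) * u i"
      using that(2) by (simp add: gradient_def algebra_simps power2_eq_square power3_eq_cube)
    then show ?thesis using that(1) by simp
  qed
  have "0 \<le> (\<Sum>i<N. (f i ^ 2 - g i ^ 2) * ((\<Sum>j<N. A i j * f j) / f i - (\<Sum>j<N. A i j * g j) / g i))"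
    using sym off f g by (rule diaz_saa)
  also have "\<dots> = (\<Sum>i<N. (\<mu> - \<nu>) * (f i ^ 2 - g i ^ 2) - \<beta> * (f i ^ 2 - g i ^ 2) ^ 2)"
  proof (intro sum.cong refl)
    fix i assume "i \<in> {..<N}"
    then have "i < N" by simp
    show "(f i ^ 2 - g i ^ 2) * ((\<Sum>j<N. A i j * f j) / f i - (\<Sum>j<N. A i j * g j) / g i) =
        (\<mu> - \<nu>) * (f i ^ 2 - g i ^ 2) - \<beta> * (f i ^ 2 - g i ^ 2) ^ 2"
      unfolding quot[where u = f, OF f ef, OF \<open>i < N\<close> \<open>i < N\<close>]
        quot[where u = g, OF g eg, OF \<open>i < N\<close> \<open>i < N\<close>]
      by (simp add: power2_eq_square algebra_simps)
  qed
  also have "\<dots> = (\<mu> - \<nu>) * ((\<Sum>i<N. f i ^ 2) - (\<Sum>i<N. g i ^ 2)) - \<beta> * (\<Sum>i<N. (f i ^ 2 - g i ^ 2) ^ 2)"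
    by (simp add: sum_subtractf sum_distrib_left right_diff_distrib)
  also have "\<dots> = - (\<beta> * (\<Sum>i<N. (f i ^ 2 - g i ^ 2) ^ 2))"
    by (simp add: norm)
  finally have "(\<Sum>i<N. (f i ^ 2 - g i ^ 2) ^ 2) \<le> 0"
    using \<open>0 < \<beta>\<close> by (simp add: mult_le_0_iff)
  then have "(\<Sum>i<N. (f i ^ 2 - g i ^ 2) ^ 2) = 0"
    by (intro antisym sum_nonneg) auto
  then have "(f i ^ 2 - g i ^ 2) ^ 2 = 0"
    using \<open>i < N\<close> by (simp add: sum_nonneg_eq_0_iff)
  then have "f i ^ 2 = g i ^ 2"
    by simp
  then show ?thesis
    using f[OF \<open>i < N\<close>] g[OF \<open>i < N\<close>] by (simp add: power2_eq_iff_nonneg)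
qed

section \<open>Transfer to matrices and vectors\<close>

text \<open>The squared norm \<open>r\<close> is kept general to cover the normalizations of both
  discretizations.\<close>

lemma positive_eigenvector_ex1:
  fixes M :: "real mat"
  assumes M: "M \<in> carrier_mat N N"
    and sym: "\<And>i j. i < N \<Longrightarrow> j < N \<Longrightarrow> M $$ (i, j) = M $$ (j, i)"
    and off: "\<And>i j. i < N \<Longrightarrow> j < N \<Longrightarrow> i \<noteq> j \<Longrightarrow> M $$ (i, j) \<le> 0"
    and irr: "irreducible_mat N (\<lambda>i j. M $$ (i, j))"
    and "0 < \<beta>" "0 < r" "0 < N"
  shows "\<exists>!\<phi>. \<phi> \<in> carrier_vec N \<and> positive_vec \<phi> \<and>
          (\<exists>\<mu>::real. (M *\<^sub>v \<phi> + \<beta> \<cdot>\<^sub>v cube_vec \<phi>) - \<mu> \<cdot>\<^sub>v \<phi> = 0\<^sub>v N \<and>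
             1/2 * (r - \<phi> \<bullet> \<phi>) = 0)"
proof -
  let ?A = "\<lambda>i j. M $$ (i, j)"
  have eig: "(M *\<^sub>v \<phi> + \<beta> \<cdot>\<^sub>v cube_vec \<phi>) - \<mu> \<cdot>\<^sub>v \<phi> = 0\<^sub>v N \<longleftrightarrow>
      (\<forall>i<N. gradient N ?A \<beta> (($) \<phi>) i = \<mu> * \<phi> $ i)"
    if "\<phi> \<in> carrier_vec N" for \<phi> \<mu>
    using that M
    by (auto simp: vec_eq_iff gradient_def cube_vec_def scalar_prod_def atLeast0LessThan)
  have norm: "1/2 * (r - \<phi> \<bullet> \<phi>) = 0 \<longleftrightarrow> (\<Sum>i<N. (\<phi> $ i) ^ 2) = r"
    if "\<phi> \<in> carrier_vec N" for \<phi>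
    using that by (auto simp: scalar_prod_def atLeast0LessThan power2_eq_square)
  obtain f \<mu> where f: "\<And>i. i < N \<Longrightarrow> 0 < f i" "(\<Sum>i<N. f i ^ 2) = r"
    "\<And>i. i < N \<Longrightarrow> gradient N ?A \<beta> f i = \<mu> * f i"
    using positive_eigenfunction_exists[of N ?A r \<beta>] sym off irr \<open>0 < r\<close> \<open>0 < N\<close> by blast
  show ?thesis
  proof (rule ex1I)
    have c: "vec N f \<in> carrier_vec N" by simp
    \<comment> \<open>Only components below \<open>N\<close> enter the gradient, and there
      \<open>vec N f\<close> agrees with \<open>f\<close>.\<close>
    have "gradient N ?A \<beta> (($) (vec N f)) i = gradient N ?A \<beta> f i" if "i < N" for i
      using that by (simp add: gradient_def)
    then show "vec N f \<in> carrier_vec N \<and> positive_vec (vec N f) \<and>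
        (\<exists>\<mu>. (M *\<^sub>v vec N f + \<beta> \<cdot>\<^sub>v cube_vec (vec N f)) - \<mu> \<cdot>\<^sub>v vec N f = 0\<^sub>v N \<and>
           1/2 * (r - vec N f \<bullet> vec N f) = 0)"
      unfolding eig[OF c] norm[OF c] using f by (auto simp: positive_vec_def)
  next
    fix \<phi>
    assume \<phi>: "\<phi> \<in> carrier_vec N \<and> positive_vec \<phi> \<and>
        (\<exists>\<mu>. (M *\<^sub>v \<phi> + \<beta> \<cdot>\<^sub>v cube_vec \<phi>) - \<mu> \<cdot>\<^sub>v \<phi> = 0\<^sub>v N \<and> 1/2 * (r - \<phi> \<bullet> \<phi>) = 0)"
    then have c: "\<phi> \<in> carrier_vec N" by blast
    from \<phi> obtain \<nu> where \<nu>: "\<And>i. i < N \<Longrightarrow> gradient N ?A \<beta> (($) \<phi>) i = \<nu> * \<phi> $ i"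
      and n: "(\<Sum>i<N. (\<phi> $ i) ^ 2) = r"
      unfolding eig[OF c] norm[OF c] by blast
    have pos: "0 < \<phi> $ i" if "i < N" for i
      using \<phi> that by (auto simp: positive_vec_def)
    have "\<phi> $ i = f i" if "i < N" for i
      by (rule positive_eigenfunction_unique[of N ?A \<beta> "($) \<phi>" f \<nu> \<mu> i])
        (use sym off \<open>0 < \<beta>\<close> pos f \<nu> n that in auto)
    then show "\<phi> = vec N f"
      using c by (intro eq_vecI) auto
  qed
qed

section \<open>Sign and connectivity of the discretization matrices\<close>

lemma mesh_pos: "a < b \<Longrightarrow> 0 < mesh a b n"
  by (simp add: mesh_def)

text \<open>A path is connected: descend from \<open>k\<close> to 0, then climb to
  \<open>l\<close>.\<close>

lemma spread_along_path:
  assumes "k < (n::nat)" "P k" "l < n"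
    and up: "\<And>i. Suc i < n \<Longrightarrow> P i \<Longrightarrow> P (Suc i)"
    and down: "\<And>i. Suc i < n \<Longrightarrow> P (Suc i) \<Longrightarrow> P i"
  shows "P l"
proof -
  have "P 0"
    using assms(1,2) by (induction k) (auto dest: down)
  then show ?thesis
    using assms(3) by (induction l) (auto intro: up)
qed

lemma D_1d_carrier: "D_1d a b n \<in> carrier_mat n n"
  by (simp add: D_1d_def tridiag_def mat_diag_def)

lemma D_1d_index:
  assumes "i < n" "j < n"
  shows "D_1d a b n $$ (i, j) =
    (if i = j then 1 / mesh a b n ^ 2 + V1 (grid_point a b n (Suc i))
     else if i = Suc j \<or> j = Suc i then - (1 / (2 * mesh a b n ^ 2)) else 0)"
  using assms by (simp add: D_1d_def tridiag_def mat_diag_def)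

lemma D_1d_irreducible:
  assumes "a < b"
  shows "irreducible_mat n (\<lambda>i j. D_1d a b n $$ (i, j))"
  unfolding irreducible_mat_def
proof (intro allI impI)
  fix P :: "nat \<Rightarrow> bool" and l
  assume ex: "\<exists>k<n. P k" and l: "l < n"
    and step: "\<forall>k<n. \<forall>l<n. P k \<longrightarrow> D_1d a b n $$ (k, l) \<noteq> 0 \<longrightarrow> P l"
  from ex obtain k where "k < n" "P k" by blast
  then show "P l"
    using l
  proof (rule spread_along_path)
    have neq: "D_1d a b n $$ (i, Suc i) \<noteq> 0" "D_1d a b n $$ (Suc i, i) \<noteq> 0" if "Suc i < n" for i
      using that mesh_pos[OF assms, of n] by (simp_all add: D_1d_index)
    show "P (Suc i)" if "Suc i < n" "P i" for i
      using step neq[OF that(1)] that Suc_lessD by blast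
    show "P i" if "Suc i < n" "P (Suc i)" for i
      using step neq[OF that(1)] that Suc_lessD by blast
  qed
qed

lemma D_2d_carrier: "D_2d a b c d m n \<in> carrier_mat (m * n) (m * n)"
  by (simp add: D_2d_def)

text \<open>The five-point stencil, with position \<open>k\<close> read as the grid node
  \<open>(k div n, k mod n)\<close>. Comparing quotients and remainders separately keeps the end of
  one block uncoupled from the start of the next.\<close>

lemma D_2d_index:
  assumes "k < m * n" "l < m * n"
  shows "D_2d a b c d m n $$ (k, l) =
    (if k div n = l div n
     then if k mod n = l mod n
       then 1 / mesh a b m ^ 2 + 1 / mesh c d n ^ 2
         + V2 (grid_point a b m (Suc (k div n))) (grid_point c d n (Suc (k mod n)))
       else if k mod n = Suc (l mod n) \<or> l mod n = Suc (k mod n)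
       then - (1 / (2 * mesh c d n ^ 2)) else 0
     else if (k div n = Suc (l div n) \<or> l div n = Suc (k div n)) \<and> k mod n = l mod n
     then - (1 / (2 * mesh a b m ^ 2)) else 0)"
proof -
  have block: "block_2d a b c d m n p p' $$ (q, q') =
    (if p = p'
     then if q = q'
       then 1 / mesh a b m ^ 2 + 1 / mesh c d n ^ 2
         + V2 (grid_point a b m (Suc p)) (grid_point c d n (Suc q))
       else if q = Suc q' \<or> q' = Suc q then - (1 / (2 * mesh c d n ^ 2)) else 0
     else if (p = Suc p' \<or> p' = Suc p) \<and> q = q'
     then - (1 / (2 * mesh a b m ^ 2)) else 0)"
    if "q < n" "q' < n" for p p' q q'
    using that
    by (simp add: block_2d_def diag_block_2d_def tridiag_def mat_diag_def Let_def add_divide_distrib)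
  have "0 < n" using assms by (cases n) auto
  then show ?thesis
    using assms by (simp add: D_2d_def block)
qed

text \<open>The grid graph is connected: cross the blocks at a fixed offset, then move within the
  target block.\<close>

lemma D_2d_irreducible:
  assumes "a < b" "c < d"
  shows "irreducible_mat (m * n) (\<lambda>i j. D_2d a b c d m n $$ (i, j))"
  unfolding irreducible_mat_def
proof (intro allI impI)
  fix P :: "nat \<Rightarrow> bool" and l
  assume ex: "\<exists>k<m * n. P k" and l: "l < m * n"
    and step: "\<forall>k<m * n. \<forall>l<m * n. P k \<longrightarrow> D_2d a b c d m n $$ (k, l) \<noteq> 0 \<longrightarrow> P l"
  from ex obtain k where k: "k < m * n" "P k" by blast
  have "0 < n" using l by (cases n) auto
  \<comment> \<open>Adjacent grid nodes are coupled by a nonzero entry because both step sizes are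
    positive.\<close>
  have neighbour: "P (p' * n + q')"
    if "P (p * n + q)" "p < m" "q < n" "p' < m" "q' < n"
      "p = p' \<and> (q = Suc q' \<or> q' = Suc q) \<or> (p = Suc p' \<or> p' = Suc p) \<and> q = q'"
    for p q p' q'
  proof -
    have lt: "i * n + j < m * n" if "i < m" "j < n" for i j
    proof -
      have "i * n + j < Suc i * n" using that by simp
      also have "\<dots> \<le> m * n" using that by (intro mult_le_mono1) simp
      finally show ?thesis .
    qed
    have divmod: "(i * n + j) div n = i" "(i * n + j) mod n = j" if "j < n" for i j
      using that by simp_all
    have "D_2d a b c d m n $$ (p * n + q, p' * n + q') \<noteq> 0"
      unfolding D_2d_index[OF lt[OF that(2,3)] lt[OF that(4,5)]] divmod[OF that(3)] divmod[OF that(5)]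
      using that(6) mesh_pos[OF assms(1), of m] mesh_pos[OF assms(2), of n] by auto
    then show ?thesis
      using step lt that by blast
  qed
  have row: "P (p * n + q')" if "p < m" "q < n" "P (p * n + q)" "q' < n" for p q q'
    by (rule spread_along_path[where P = "\<lambda>i. P (p * n + i)", OF that(2-4)])
      (use neighbour[of p _ p] that(1) in \<open>auto dest: Suc_lessD simp del: add_Suc_right\<close>)
  have col: "P (p' * n + q)" if "q < n" "p < m" "P (p * n + q)" "p' < m" for p p' q
    by (rule spread_along_path[where P = "\<lambda>i. P (i * n + q)", OF that(2-4)])
      (use neighbour[of _ q _ q] that(1) in \<open>auto dest: Suc_lessD simp del: mult_Suc\<close>)
  have "k div n < m" "l div n < m"
    using k l by (simp_all add: less_mult_imp_div_less)
  then have "P (l div n * n + l mod n)"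
    using row[of "l div n" "k mod n" "l mod n"] col[of "k mod n" "k div n" "l div n"] k \<open>0 < n\<close>
    by simp
  then show "P l" by simp
qed

theorem theorem2p5:
  fixes \<beta> :: real
  assumes "\<beta> > 0"
  shows
    "(\<forall>(a::real) (b::real) (n::nat). a < b \<longrightarrow> n \<ge> 1 \<longrightarrow>
        (\<exists>!\<phi>. \<phi> \<in> carrier_vec n \<and> positive_vec \<phi> \<and>
          (\<exists>\<mu>::real.
             (D_1d a b n *\<^sub>v \<phi> + \<beta> \<cdot>\<^sub>v cube_vec \<phi>) - \<mu> \<cdot>\<^sub>v \<phi> = 0\<^sub>v n \<and>
             1/2 * (1 / mesh a b n - \<phi> \<bullet> \<phi>) = 0))) \<and>
     (\<forall>(a::real) (b::real) (c::real) (d::real) (m::nat) (n::nat).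
        a < b \<longrightarrow> c < d \<longrightarrow> m \<ge> 1 \<longrightarrow> n \<ge> 1 \<longrightarrow>
        (\<exists>!\<phi>. \<phi> \<in> carrier_vec (m * n) \<and> positive_vec \<phi> \<and>
          (\<exists>\<mu>::real.
             (D_2d a b c d m n *\<^sub>v \<phi> + \<beta> \<cdot>\<^sub>v cube_vec \<phi>) - \<mu> \<cdot>\<^sub>v \<phi> = 0\<^sub>v (m * n) \<and>
             1/2 * (1 / (mesh a b m * mesh c d n) - \<phi> \<bullet> \<phi>) = 0)))"
proof (intro conjI allI impI)
  fix a b :: real and n :: nat
  assume "a < b" "1 \<le> n"
  then show "\<exists>!\<phi>. \<phi> \<in> carrier_vec n \<and> positive_vec \<phi> \<and>
          (\<exists>\<mu>::real.
             (D_1d a b n *\<^sub>v \<phi> + \<beta> \<cdot>\<^sub>v cube_vec \<phi>) - \<mu> \<cdot>\<^sub>v \<phi> = 0\<^sub>v n \<and>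
             1/2 * (1 / mesh a b n - \<phi> \<bullet> \<phi>) = 0)"
    using assms mesh_pos
    by (intro positive_eigenvector_ex1 D_1d_carrier D_1d_irreducible) (auto simp: D_1d_index)
next
  fix a b c d :: real and m n :: nat
  assume ab: "a < b" and cd: "c < d" and "1 \<le> m" "1 \<le> n"
  \<comment> \<open>Distinct positions differ in quotient or remainder, so the diagonal case of the
    stencil cannot arise off the diagonal.\<close>
  have same: "k = l" if "k div n = l div n" "k mod n = l mod n" for k l
    using that by (metis div_mult_mod_eq)
  show "\<exists>!\<phi>. \<phi> \<in> carrier_vec (m * n) \<and> positive_vec \<phi> \<and>
          (\<exists>\<mu>::real.
             (D_2d a b c d m n *\<^sub>v \<phi> + \<beta> \<cdot>\<^sub>v cube_vec \<phi>) - \<mu> \<cdot>\<^sub>v \<phi> = 0\<^sub>v (m * n) \<and>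
             1/2 * (1 / (mesh a b m * mesh c d n) - \<phi> \<bullet> \<phi>) = 0)"
  proof (rule positive_eigenvector_ex1)
    show "D_2d a b c d m n $$ (i, j) \<le> 0" if "i < m * n" "j < m * n" "i \<noteq> j" for i j
      using that same[of i j] by (auto simp: D_2d_index)
    show "D_2d a b c d m n $$ (i, j) = D_2d a b c d m n $$ (j, i)"
      if "i < m * n" "j < m * n" for i j
      using that by (auto simp: D_2d_index)
    show "0 < 1 / (mesh a b m * mesh c d n)"
      using mesh_pos[OF ab] mesh_pos[OF cd] by simp
  qed (use ab cd assms \<open>1 \<le> m\<close> \<open>1 \<le> n\<close> in \<open>auto intro: D_2d_carrier D_2d_irreducible\<close>)
qed

end
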